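(* Let $\mathcal I$ be an ideal on $\omega$ that is weakly selective and $q^+$. Then for every $Y\in\mathcal I^+$ we have $\mathcal{ED}_{\mathrm{fin}}\not\le_K\mathcal I\upharpoonright Y$. Consequently, for every ideal $\mathcal J\subseteq\mathcal I$ and every $Y\in\mathcal I^+$, $\mathcal{ED}_{\mathrm{fin}}\not\le_K\mathcal J\upharpoonright Y$.
   Context: Ideals on a countable set are proper and contain all finite sets. $\mathcal I^+=\mathcal P(\omega)\setminus\mathcal I$; $\mathcal I\upharpoonright Y=\{A\subseteq\omega:A\cap Y\in\mathcal I\}$. For ideals $\mathcal I$ on $E$ and $\mathcal J$ on $D$, $\mathcal I\le_K\mathcal J$ (Katětov reducibility) means there is $f:D\to E$ (a witness) with $f^{-1}[A]\in\mathcal J$ for all $A\in\mathcal I$. $\mathcal I$ is weakly selective if every partition of an $\mathcal I$-positive set into pieces belonging to $\mathcal I$ has an $\mathcal I$-positive selector (a subset of the partitioned set meeting each piece in at most one point). $\mathcal I$ is $q^+$ if every partition of an $\mathcal I$-positive set into finite pieces has an $\mathcal I$-positive selector. Let $\Delta=\{(n,m)\in\omega\times\omega:m\le n\}$; $\mathcal{ED}_{\mathrm{fin}}$ is the ideal on $\Delta$ of all $A\subseteq\Delta$ for which there are $k,n_0$ with $|\{m:(n,m)\in A\}|\le k$ for all $n\ge n_0$. *)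

theory Defs
  imports Main "HOL-Library.Countable_Set" "HOL-Library.Disjoint_Sets" "HOL-Library.FuncSet"
begin

definition ideal_on :: "'a set \<Rightarrow> 'a set set \<Rightarrow> bool" where
  "ideal_on E I \<longleftrightarrow>
     countable E \<and> I \<subseteq> Pow E \<and> E \<notin> I \<and>
     (\<forall>A. A \<subseteq> E \<and> finite A \<longrightarrow> A \<in> I) \<and>
     (\<forall>A B. A \<in> I \<and> B \<subseteq> A \<longrightarrow> B \<in> I) \<and>
     (\<forall>A B. A \<in> I \<and> B \<in> I \<longrightarrow> A \<union> B \<in> I)"

definition positive_sets :: "'a set \<Rightarrow> 'a set set \<Rightarrow> 'a set set" where
  "positive_sets E I = Pow E - I"

text \<open>The restriction to \<open>Y\<close> is a family of subsets of the whole carrier \<open>E\<close>, not of \<open>Y\<close>.\<close>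

definition ideal_restrict :: "'a set \<Rightarrow> 'a set set \<Rightarrow> 'a set \<Rightarrow> 'a set set" where
  "ideal_restrict E I Y = {A. A \<subseteq> E \<and> A \<inter> Y \<in> I}"

text \<open>\<open>katetov_le E I D J\<close>: the family \<open>I\<close> on \<open>E\<close> is Katetov-below the family \<open>J\<close> on \<open>D\<close>.\<close>

definition katetov_le :: "'a set \<Rightarrow> 'a set set \<Rightarrow> 'b set \<Rightarrow> 'b set set \<Rightarrow> bool" where
  "katetov_le E I D J \<longleftrightarrow> (\<exists>f \<in> D \<rightarrow> E. \<forall>A \<in> I. f -` A \<inter> D \<in> J)"

definition selector :: "'a set \<Rightarrow> 'a set set \<Rightarrow> 'a set \<Rightarrow> bool" where
  "selector A P S \<longleftrightarrow> S \<subseteq> A \<and> (\<forall>p \<in> P. \<exists>\<^sub>\<le>\<^sub>1 x. x \<in> S \<inter> p)"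

definition weakly_selective :: "'a set \<Rightarrow> 'a set set \<Rightarrow> bool" where
  "weakly_selective E I \<longleftrightarrow>
     (\<forall>A \<in> positive_sets E I. \<forall>P. partition_on A P \<and> (\<forall>p \<in> P. p \<in> I) \<longrightarrow>
        (\<exists>S \<in> positive_sets E I. selector A P S))"

definition q_plus :: "'a set \<Rightarrow> 'a set set \<Rightarrow> bool" where
  "q_plus E I \<longleftrightarrow>
     (\<forall>A \<in> positive_sets E I. \<forall>P. partition_on A P \<and> (\<forall>p \<in> P. finite p) \<longrightarrow>
        (\<exists>S \<in> positive_sets E I. selector A P S))"

definition Delta :: "(nat \<times> nat) set" where
  "Delta = {(n, m). m \<le> n}"

text \<open>The vertical sections of a subset of \<open>Delta\<close> are finite, so \<open>card\<close> is the true cardinality.\<close>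

definition ED_fin :: "(nat \<times> nat) set set" where
  "ED_fin = {A. A \<subseteq> Delta \<and> (\<exists>k n0. \<forall>n \<ge> n0. card {m. (n, m) \<in> A} \<le> k)}"

lemma finite_section_Delta: "A \<subseteq> Delta \<Longrightarrow> finite {m. (n, m) \<in> A}"
  by (rule finite_subset[of _ "{..n}"]) (auto simp: Delta_def)

lemma ideal_on_ED_fin: "ideal_on Delta ED_fin"
  unfolding ideal_on_def
proof (intro conjI allI impI)
  show "ED_fin \<subseteq> Pow Delta"
    by (auto simp: ED_fin_def)
  show "Delta \<notin> ED_fin"
  proof
    assume "Delta \<in> ED_fin"
    then obtain k n0 where *: "\<forall>n \<ge> n0. card {m. (n, m) \<in> Delta} \<le> k"
      by (auto simp: ED_fin_def)
    have "card {m. (n, m) \<in> Delta} = Suc n" for n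
      by (simp add: Delta_def flip: atMost_def)
    with *[rule_format, of "n0 + k"] show False by simp
  qed
next
  fix A assume A: "A \<subseteq> Delta \<and> finite A"
  then obtain N where N: "\<forall>x \<in> fst ` A. x < N"
    using finite_nat_set_iff_bounded by blast
  have "card {m. (n, m) \<in> A} \<le> 0" if "n \<ge> N" for n
  proof -
    have "{m. (n, m) \<in> A} = {}" using N that by force
    then show ?thesis by (simp only: card.empty)
  qed
  then show "A \<in> ED_fin" using A unfolding ED_fin_def by blast
next
  fix A B assume AB: "A \<in> ED_fin \<and> B \<subseteq> A"
  then obtain k n0 where k: "\<forall>n \<ge> n0. card {m. (n, m) \<in> A} \<le> k" and A: "A \<subseteq> Delta"
    by (auto simp: ED_fin_def)
  have "card {m. (n, m) \<in> B} \<le> card {m. (n, m) \<in> A}" for n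
    by (rule card_mono) (use AB finite_section_Delta[OF A] in auto)
  then have "\<forall>n \<ge> n0. card {m. (n, m) \<in> B} \<le> k" using k le_trans by blast
  then show "B \<in> ED_fin" using A AB unfolding ED_fin_def by blast
next
  fix A B assume AB: "A \<in> ED_fin \<and> B \<in> ED_fin"
  then obtain k n0 l n1 where k: "\<forall>n \<ge> n0. card {m. (n, m) \<in> A} \<le> k"
    and l: "\<forall>n \<ge> n1. card {m. (n, m) \<in> B} \<le> l" and sub: "A \<union> B \<subseteq> Delta"
    by (auto simp: ED_fin_def)
  have "card {m. (n, m) \<in> A \<union> B} \<le> k + l" if "n \<ge> max n0 n1" for n
  proof -
    have "{m. (n, m) \<in> A \<union> B} = {m. (n, m) \<in> A} \<union> {m. (n, m) \<in> B}" by auto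
    then have "card {m. (n, m) \<in> A \<union> B} \<le> card {m. (n, m) \<in> A} + card {m. (n, m) \<in> B}"
      by (simp only: card_Un_le)
    also have "\<dots> \<le> k + l" using k l that by (intro add_mono) auto
    finally show ?thesis .
  qed
  then show "A \<union> B \<in> ED_fin" using sub unfolding ED_fin_def by blast
qed simp

lemma ideal_on_ideal_restrict:
  assumes "ideal_on E I" and "Y \<in> positive_sets E I"
  shows "ideal_on E (ideal_restrict E I Y)"
proof -
  have EY: "E \<inter> Y = Y" and Y: "Y \<notin> I"
    using assms(2) by (auto simp: positive_sets_def)
  have fin: "\<And>A. A \<subseteq> E \<Longrightarrow> finite A \<Longrightarrow> A \<in> I"
    and down: "\<And>A B. A \<in> I \<Longrightarrow> B \<subseteq> A \<Longrightarrow> B \<in> I"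
    and un: "\<And>A B. A \<in> I \<Longrightarrow> B \<in> I \<Longrightarrow> A \<union> B \<in> I" and c: "countable E"
    using assms(1) unfolding ideal_on_def by blast+
  show ?thesis
    unfolding ideal_on_def ideal_restrict_def
  proof (intro conjI allI impI)
    fix A assume "A \<subseteq> E \<and> finite A"
    then show "A \<in> {A. A \<subseteq> E \<and> A \<inter> Y \<in> I}" using fin[of "A \<inter> Y"] by auto
  next
    fix A B assume "A \<in> {A. A \<subseteq> E \<and> A \<inter> Y \<in> I} \<and> B \<subseteq> A"
    then show "B \<in> {A. A \<subseteq> E \<and> A \<inter> Y \<in> I}" using down[of "A \<inter> Y" "B \<inter> Y"] by auto
  next
    fix A B assume "A \<in> {A. A \<subseteq> E \<and> A \<inter> Y \<in> I} \<and> B \<in> {A. A \<subseteq> E \<and> A \<inter> Y \<in> I}"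
    then show "A \<union> B \<in> {A. A \<subseteq> E \<and> A \<inter> Y \<in> I}" using un by (auto simp: Int_Un_distrib2)
  qed (use c EY Y in auto)
qed

end

theory Submission
  imports Defs
begin

text \<open>Let \<open>f\<close> witness the reduction. The columns of \<open>Delta\<close> are finite, hence belong to
  \<open>ED_fin\<close>, so their preimages split \<open>Y\<close> into pieces from \<open>I\<close>. A positive selector \<open>S\<close> for this
  partition has an image meeting every column in at most one point, so \<open>f ` S\<close> is in \<open>ED_fin\<close>
  although its preimage contains the positive set \<open>S\<close>.\<close>

lemma not_katetov_ED_fin_restrict:
  assumes "ideal_on E I" and "weakly_selective E I" and Y: "Y \<in> positive_sets E I"
  shows "\<not> katetov_le Delta ED_fin E (ideal_restrict E I Y)"
proof
  assume "katetov_le Delta ED_fin E (ideal_restrict E I Y)"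
  then obtain f where f: "f \<in> E \<rightarrow> Delta"
    and pre: "\<And>A. A \<in> ED_fin \<Longrightarrow> f -` A \<inter> E \<inter> Y \<in> I"
    unfolding katetov_le_def ideal_restrict_def by blast
  have YE: "Y \<subseteq> E" using Y by (auto simp: positive_sets_def)
  have down: "\<And>A B. A \<in> I \<Longrightarrow> B \<subseteq> A \<Longrightarrow> B \<in> I"
    using assms(1) unfolding ideal_on_def by blast
  define col where "col n = {x \<in> Y. fst (f x) = n}" for n
  have col: "col n \<in> I" for n
  proof -
    have "{n} \<times> {..n} \<subseteq> Delta" by (auto simp: Delta_def)
    then have "{n} \<times> {..n} \<in> ED_fin"
      using ideal_on_ED_fin unfolding ideal_on_def by blast
    \<comment> \<open>Since \<open>f x\<close> lies in \<open>Delta\<close>, its second coordinate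
      is at most its first, here \<open>n\<close>.\<close>
    moreover have "col n \<subseteq> f -` ({n} \<times> {..n}) \<inter> E \<inter> Y"
      using f YE by (fastforce simp: col_def Delta_def Pi_iff)
    ultimately show ?thesis using pre down by blast
  qed
  \<comment> \<open>Columns that \<open>f\<close> misses on \<open>Y\<close> give an empty
    \<open>col n\<close>, which a partition must not contain.\<close>
  have "partition_on Y (range col - {{}})"
    by (rule partition_onI) (auto simp: col_def disjnt_def)
  moreover have "\<forall>p \<in> range col - {{}}. p \<in> I" using col by blast
  ultimately obtain S where S: "S \<in> positive_sets E I" "S \<subseteq> Y"
    and sel: "\<And>p. p \<in> range col - {{}} \<Longrightarrow> \<exists>\<^sub>\<le>\<^sub>1 x. x \<in> S \<inter> p"
    using assms(2) Y unfolding weakly_selective_def selector_def by meson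
  \<comment> \<open>Both points lie in the same \<open>col\<close>, which is therefore nonempty and
    one of the pieces that \<open>S\<close> selects from.\<close>
  have inj: "x = y" if "x \<in> S" "y \<in> S" "fst (f x) = fst (f y)" for x y
  proof -
    have "x \<in> S \<inter> col (fst (f x))" "y \<in> S \<inter> col (fst (f x))"
      using that S(2) by (auto simp: col_def)
    then show ?thesis using sel[of "col (fst (f x))"] by (blast dest: Uniq_D)
  qed
  have "card {m. (n, m) \<in> f ` S} \<le> 1" for n
  proof -
    have "m = m'" if mm: "(n, m) \<in> f ` S" "(n, m') \<in> f ` S" for m m'
    proof -
      obtain x y where "x \<in> S" "y \<in> S" "f x = (n, m)" "f y = (n, m')"
        using mm by (metis imageE)
      then show ?thesis using inj[of x y] by simp
    qed
    \<comment> \<open>In the infinite case the bound holds because \<open>card\<close> defaults to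
      0.\<close>
    then show ?thesis by (cases "finite {m. (n, m) \<in> f ` S}") (auto simp: card_le_Suc0_iff_eq)
  qed
  moreover have "f ` S \<subseteq> Delta" using f S(2) YE by (blast dest: funcset_mem)
  ultimately have "f ` S \<in> ED_fin" unfolding ED_fin_def by blast
  moreover have "S \<subseteq> f -` (f ` S) \<inter> E \<inter> Y" using S(2) YE by auto
  ultimately have "S \<in> I" using pre down by blast
  then show False using S(1) by (simp add: positive_sets_def)
qed

lemma katetov_le_mono:
  "katetov_le E I D J \<Longrightarrow> J \<subseteq> J' \<Longrightarrow> katetov_le E I D J'"
  unfolding katetov_le_def by blast

lemma ideal_restrict_mono:
  "J \<subseteq> I \<Longrightarrow> ideal_restrict E J Y \<subseteq> ideal_restrict E I Y"
  unfolding ideal_restrict_def by blast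

theorem theoremC:
  fixes I :: "nat set set"
  assumes "ideal_on UNIV I"
    and "weakly_selective UNIV I"
    and "q_plus UNIV I"
  shows "(\<forall>Y \<in> positive_sets UNIV I.
            \<not> katetov_le Delta ED_fin UNIV (ideal_restrict UNIV I Y)) \<and>
         (\<forall>J. ideal_on UNIV J \<and> J \<subseteq> I \<longrightarrow>
            (\<forall>Y \<in> positive_sets UNIV I.
               \<not> katetov_le Delta ED_fin UNIV (ideal_restrict UNIV J Y)))"
  \<comment> \<open>For the second part, a witness for the restriction of \<open>J\<close> is also
    one for the larger restriction of \<open>I\<close> to the same \<open>Y\<close>, which the first
    part excludes.\<close>
  using not_katetov_ED_fin_restrict[OF assms(1,2)] katetov_le_mono ideal_restrict_mono by metis

end
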